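(* There exist $d\in\mathbb{N}$, constants $\delta=\delta(d)\in(0,1)$ and $\epsilon=\epsilon(d)\in(0,1)$, and a sequence $(G_N)_{N\in\mathbb{N}}$ of graphs of maximum degree at most $d$ and of increasing order, such that for every $N\in\mathbb{N}$ the graph $G_N$ is $\delta$-locally Hamiltonian on $\mathcal{C}_d$ and $\epsilon$-far from being Hamiltonian.
   Context: All graphs are finite, simple and undirected. $\mathcal{C}_d$ denotes the class of all graphs of maximum degree at most $d$. A Hamiltonian cycle is a cycle visiting every vertex exactly once; a graph is Hamiltonian if it has one. For $S\subseteq V(G)$, $N_G(S)$ is the closed neighbourhood $S\cup\{v: v \text{ adjacent to some } w\in S\}$, and $G[X]$ is the induced subgraph on $X$. A graph $G\in\mathcal{C}_d$ is $\epsilon$-far from being Hamiltonian if for every set $E$ of 2-element subsets of $V(G)$ with $|E|\le \epsilon d|V(G)|$, the graph $(V(G),E(G)\triangle E)$ is not Hamiltonian. For a graph class $\mathcal{C}$ and $\delta\in(0,1]$, a graph $G\in\mathcal{C}$ is $\delta$-locally Hamiltonian on $\mathcal{C}$ if for every $S\subseteq V(G)$ with $|S|\le\delta|V(G)|$ there exist a Hamiltonian graph $H\in\mathcal{C}$ with $|V(H)|=|V(G)|$, a set $T\subseteq V(H)$, and an isomorphism from $G[N_G(S)]$ to $H[N_H(T)]$ mapping $S$ onto $T$. *)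

theory Defs
  imports Complex_Main
begin

record 'a ugraph =
  verts :: "'a set"
  edges :: "'a set set"

definition simple_graph :: "'a ugraph \<Rightarrow> bool" where
  "simple_graph G \<longleftrightarrow> finite (verts G) \<and> (\<forall>e\<in>edges G. e \<subseteq> verts G \<and> card e = 2)"

definition degree :: "'a ugraph \<Rightarrow> 'a \<Rightarrow> nat" where
  "degree G v = card {w \<in> verts G. {v, w} \<in> edges G}"

definition bounded_degree_graphs :: "nat \<Rightarrow> 'a ugraph set" where
  "bounded_degree_graphs d = {G. simple_graph G \<and> (\<forall>v\<in>verts G. degree G v \<le> d)}"

text \<open>A cycle is given by the list of its distinct vertices in cyclic order, without repeating
  the first vertex at the end. Cycles in simple graphs have at least three vertices.\<close>

definition is_cycle :: "'a ugraph \<Rightarrow> 'a list \<Rightarrow> bool" where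
  "is_cycle G xs \<longleftrightarrow>
     3 \<le> length xs \<and> distinct xs \<and> set xs \<subseteq> verts G \<and>
     (\<forall>i<length xs. {xs ! i, xs ! ((i + 1) mod length xs)} \<in> edges G)"

definition hamiltonian :: "'a ugraph \<Rightarrow> bool" where
  "hamiltonian G \<longleftrightarrow> (\<exists>xs. is_cycle G xs \<and> set xs = verts G)"

definition closed_nbhd :: "'a ugraph \<Rightarrow> 'a set \<Rightarrow> 'a set" where
  "closed_nbhd G S = S \<union> {v \<in> verts G. \<exists>w\<in>S. {v, w} \<in> edges G}"

definition induced :: "'a ugraph \<Rightarrow> 'a set \<Rightarrow> 'a ugraph" where
  "induced G X = \<lparr>verts = X, edges = {e \<in> edges G. e \<subseteq> X}\<rparr>"

definition graph_iso :: "('a \<Rightarrow> 'b) \<Rightarrow> 'a ugraph \<Rightarrow> 'b ugraph \<Rightarrow> bool" where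
  "graph_iso f G H \<longleftrightarrow>
     bij_betw f (verts G) (verts H) \<and>
     (\<forall>u\<in>verts G. \<forall>v\<in>verts G. {u, v} \<in> edges G \<longleftrightarrow> {f u, f v} \<in> edges H)"

definition far_from_hamiltonian :: "real \<Rightarrow> nat \<Rightarrow> 'a ugraph \<Rightarrow> bool" where
  "far_from_hamiltonian \<epsilon> d G \<longleftrightarrow>
     G \<in> bounded_degree_graphs d \<and>
     (\<forall>E. E \<subseteq> {e. e \<subseteq> verts G \<and> card e = 2} \<longrightarrow>
        real (card E) \<le> \<epsilon> * real d * real (card (verts G)) \<longrightarrow>
        \<not> hamiltonian \<lparr>verts = verts G, edges = sym_diff (edges G) E\<rparr>)"

text \<open>The witness \<open>H\<close> lives on the same vertex type as \<open>G\<close>. For an isomorphism-closed class \<open>C\<close>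
  of finite graphs this is no restriction, since \<open>H\<close> has as many vertices as \<open>G\<close> and
  can be relabelled on the vertex set of \<open>G\<close>.\<close>

definition locally_hamiltonian :: "real \<Rightarrow> 'a ugraph set \<Rightarrow> 'a ugraph \<Rightarrow> bool" where
  "locally_hamiltonian \<delta> C G \<longleftrightarrow>
     G \<in> C \<and>
     (\<forall>S. S \<subseteq> verts G \<longrightarrow> real (card S) \<le> \<delta> * real (card (verts G)) \<longrightarrow>
        (\<exists>H\<in>C. hamiltonian H \<and> card (verts H) = card (verts G) \<and>
           (\<exists>T f. T \<subseteq> verts H \<and>
              graph_iso f (induced G (closed_nbhd G S)) (induced H (closed_nbhd H T)) \<and>
              f ` S = T)))"

end

theory Submission
  imports Defs "HOL-Combinatorics.Permutations"
begin

text \<open>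
  Take a cycle on \<open>m\<close> rim vertices and \<open>2 m\<close> further, pairwise non-adjacent vertices,
  each of which may be inserted into the cycle at any of four slots: it is adjacent to both ends
  of each of four rim edges. The independent set contains two thirds of all vertices, so a
  Hamiltonian cycle uses at least \<open>m\<close> edges inside it, all of which would have to be added.

  The slots are given by four permutations under which small sets expand by a factor of two; these
  exist by a union bound. Hence Hall's theorem yields, for a small \<open>S\<close>, distinct slots for
  all independent vertices in the closed neighbourhood of \<open>S\<close>, and inserting these vertices
  produces a cycle of the graph. All the remaining vertices lie outside this neighbourhood, and
  are strung along a new path that is inserted at one rim edge avoiding \<open>S\<close>.
\<close>

section \<open>Hall's theorem\<close>

text \<open>If some nonempty proper subset \<open>Y\<close> is tight, \<open>Y\<close> and
  \<open>X - Y\<close> are served separately, the latter avoiding everything available to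
  \<open>Y\<close>. Otherwise every such subset has a value to spare, so one element may take any of
  its values.\<close>

lemma hall_distinct_representatives:
  assumes "finite X" "\<And>x. x \<in> X \<Longrightarrow> finite (Q x)"
    and "\<And>Y. Y \<subseteq> X \<Longrightarrow> card Y \<le> card (\<Union>(Q ` Y))"
  shows "\<exists>g. inj_on g X \<and> (\<forall>x\<in>X. g x \<in> Q x)"
  using assms
proof (induction X arbitrary: Q rule: finite_psubset_induct)
  case (psubset X)
  note finQ = psubset.prems(1) and H = psubset.prems(2)
  consider "X = {}" | Y where "Y \<noteq> {}" "Y \<subset> X" "card (\<Union>(Q ` Y)) \<le> card Y"
    | "X \<noteq> {}" "\<And>Y. Y \<noteq> {} \<Longrightarrow> Y \<subset> X \<Longrightarrow> card Y < card (\<Union>(Q ` Y))"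
    by (meson not_less)
  then show ?case
  proof cases
    case 1
    then show ?thesis by auto
  next
    case (2 Y)
    let ?U = "\<Union>(Q ` Y)"
    have finY: "finite Y" and YX: "Y \<subseteq> X"
      using 2(2) psubset.hyps finite_subset by auto
    have finU: "finite ?U" using finY YX finQ by blast
    have "\<exists>g. inj_on g Y \<and> (\<forall>x\<in>Y. g x \<in> Q x)"
    proof (rule psubset.IH[OF 2(2)])
      show "finite (Q x)" if "x \<in> Y" for x using that YX by (intro finQ) auto
      show "card Z \<le> card (\<Union>(Q ` Z))" if "Z \<subseteq> Y" for Z using that YX by (intro H) auto
    qed
    then obtain g where g: "inj_on g Y" "\<And>x. x \<in> Y \<Longrightarrow> g x \<in> Q x" by blast
    have "\<exists>h. inj_on h (X - Y) \<and> (\<forall>x\<in>X - Y. h x \<in> Q x - ?U)"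
    proof (rule psubset.IH)
      show "X - Y \<subset> X" using 2 by auto
      show "finite (Q x - ?U)" if "x \<in> X - Y" for x using that finQ by auto
      \<comment> \<open>Hall's condition for \<open>Z \<union> Y\<close> leaves enough for
        \<open>Z\<close>, because \<open>Y\<close> claims at most \<open>card Y\<close>
        values.\<close>
      fix Z assume Z: "Z \<subseteq> X - Y"
      have finZ: "finite Z" using Z psubset.hyps finite_subset by (metis finite_Diff)
      have "card Z + card Y = card (Z \<union> Y)"
        using Z finY finZ by (intro card_Un_disjoint[symmetric]) auto
      also have "\<dots> \<le> card (\<Union>(Q ` (Z \<union> Y)))"
        using Z YX by (intro H) auto
      also have "\<Union>(Q ` (Z \<union> Y)) = (\<Union>x\<in>Z. Q x - ?U) \<union> ?U" by auto
      also have "card \<dots> \<le> card (\<Union>x\<in>Z. Q x - ?U) + card ?U" by (rule card_Un_le)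
      finally show "card Z \<le> card (\<Union>x\<in>Z. Q x - ?U)" using 2(3) by linarith
    qed
    then obtain h where h: "inj_on h (X - Y)" "\<And>x. x \<in> X - Y \<Longrightarrow> h x \<in> Q x - ?U" by blast
    let ?f = "\<lambda>x. if x \<in> Y then g x else h x"
    have "inj_on ?f X"
    proof (rule inj_onI)
      fix x y assume xy: "x \<in> X" "y \<in> X" "?f x = ?f y"
      have disj: "g u \<noteq> h v" if "u \<in> Y" "v \<in> X - Y" for u v
        using g(2)[OF that(1)] h(2)[OF that(2)] that(1) by force
      consider "x \<in> Y" "y \<in> Y" | "x \<notin> Y" "y \<notin> Y" | "x \<in> Y" "y \<notin> Y" | "x \<notin> Y" "y \<in> Y"
        by blast
      then show "x = y"
      proof cases
        case 1
        then show ?thesis using xy g(1) by (simp add: inj_on_eq_iff)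
      next
        case 2
        then show ?thesis using xy inj_onD[OF h(1), of x y] by simp
      next
        case 3
        then show ?thesis using xy disj[of x y] by simp
      next
        case 4
        then show ?thesis using xy disj[of y x] by simp
      qed
    qed
    moreover have "\<forall>x\<in>X. ?f x \<in> Q x" using g h by auto
    ultimately show ?thesis by blast
  next
    case 3
    then obtain x where x: "x \<in> X" by blast
    have "card {x} \<le> card (\<Union>(Q ` {x}))" using x by (intro H) auto
    then have "Q x \<noteq> {}" by auto
    then obtain q where q: "q \<in> Q x" by blast
    have "\<exists>h. inj_on h (X - {x}) \<and> (\<forall>y\<in>X - {x}. h y \<in> Q y - {q})"
    proof (rule psubset.IH)
      show "X - {x} \<subset> X" using x by auto
      show "finite (Q y - {q})" if "y \<in> X - {x}" for y using that finQ by auto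
      fix Z assume Z: "Z \<subseteq> X - {x}"
      have eq: "(\<Union>y\<in>Z. Q y - {q}) = \<Union>(Q ` Z) - {q}" by auto
      show "card Z \<le> card (\<Union>y\<in>Z. Q y - {q})"
      proof (cases "Z = {}")
        case False
        then have "card Z < card (\<Union>(Q ` Z))" using Z x by (intro 3(2)) auto
        then show ?thesis unfolding eq by (auto simp: card_Diff_singleton_if)
      qed simp
    qed
    then obtain h where h: "inj_on h (X - {x})" "\<And>y. y \<in> X - {x} \<Longrightarrow> h y \<in> Q y - {q}" by blast
    have "inj_on (h(x := q)) X"
      using h by (auto simp: inj_on_def)
    moreover have "\<forall>y\<in>X. (h(x := q)) y \<in> Q y" using h q by auto
    ultimately show ?thesis by blast
  qed
qed

section \<open>Adding a Hamiltonian cycle\<close>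

text \<open>Indexed exactly as in \<open>is_cycle\<close>, so that adding these edges turns
  \<open>xs\<close> into a cycle by unfolding.\<close>

definition cycle_edges :: "'a list \<Rightarrow> 'a set set" where
  "cycle_edges xs = {{xs ! i, xs ! ((i + 1) mod length xs)} | i. i < length xs}"

lemma cycle_edgesE:
  assumes "e \<in> cycle_edges xs"
  obtains i where "i < length xs" "(i + 1) mod length xs < length xs"
    "e = {xs ! i, xs ! ((i + 1) mod length xs)}"
proof -
  obtain i where i: "i < length xs" "e = {xs ! i, xs ! ((i + 1) mod length xs)}"
    using assms unfolding cycle_edges_def by blast
  moreover have "(i + 1) mod length xs < length xs"
    using i(1) by (intro mod_less_divisor) linarith
  ultimately show ?thesis using that by blast
qed

lemma cycle_edges_subset:
  assumes "e \<in> cycle_edges xs"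
  shows "e \<subseteq> set xs"
  using assms by (rule cycle_edgesE) auto

lemma card_cycle_neighbours:
  assumes "distinct xs"
  shows "card {w. {v, w} \<in> cycle_edges xs} \<le> 2"
proof (cases "v \<in> set xs")
  case False
  then have "{w. {v, w} \<in> cycle_edges xs} = {}"
    using cycle_edges_subset by fastforce
  then show ?thesis by simp
next
  case True
  define L where "L = length xs"
  obtain k where k: "k < L" "v = xs ! k" using True by (auto simp: in_set_conv_nth L_def)
  \<comment> \<open>Distinctness fixes the position \<open>k\<close> of \<open>v\<close>; its
    predecessor is written \<open>k + L - 1\<close> to avoid truncated subtraction at
    \<open>k = 0\<close>.\<close>
  have "{w. {v, w} \<in> cycle_edges xs} \<subseteq> {xs ! ((k + 1) mod L), xs ! ((k + L - 1) mod L)}"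
  proof
    fix w assume "w \<in> {w. {v, w} \<in> cycle_edges xs}"
    then obtain i where i: "i < L" "{v, w} = {xs ! i, xs ! ((i + 1) mod L)}"
      by (auto simp: cycle_edges_def L_def)
    then consider "v = xs ! i" "w = xs ! ((i + 1) mod L)" | "w = xs ! i" "v = xs ! ((i + 1) mod L)"
      by (auto simp: doubleton_eq_iff)
    then show "w \<in> {xs ! ((k + 1) mod L), xs ! ((k + L - 1) mod L)}"
    proof cases
      case 1
      then have "i = k" using assms i k by (auto simp: L_def nth_eq_iff_index_eq)
      then show ?thesis using 1 by simp
    next
      case 2
      have "(i + 1) mod L < L" by (rule mod_less_divisor) (use i(1) in linarith)
      then have "(i + 1) mod L = k"
        using 2 k nth_eq_iff_index_eq[OF assms, of "(i + 1) mod L" k] unfolding L_def by simp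
      then have "i = (k + L - 1) mod L"
        using i(1) by (cases "i + 1 = L") auto
      then show ?thesis using 2 by simp
    qed
  qed
  then have "card {w. {v, w} \<in> cycle_edges xs} \<le> card {xs ! ((k + 1) mod L), xs ! ((k + L - 1) mod L)}"
    by (intro card_mono) auto
  also have "\<dots> \<le> 2" by (simp add: card_insert_if)
  finally show ?thesis .
qed

text \<open>Each vertex has at most two neighbours along the cycle. This is the margin that a graph
  must leave below the degree bound of the class.\<close>

lemma bounded_degree_add_cycle:
  assumes G: "G \<in> bounded_degree_graphs d" and xs: "distinct xs" "set xs = verts G" "3 \<le> length xs"
  shows "\<lparr>verts = verts G, edges = edges G \<union> cycle_edges xs\<rparr> \<in> bounded_degree_graphs (d + 2)"
    (is "?H \<in> _")
proof -
  have sG: "finite (verts G)" "\<And>e. e \<in> edges G \<Longrightarrow> e \<subseteq> verts G \<and> card e = 2"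
    and dG: "\<And>v. v \<in> verts G \<Longrightarrow> degree G v \<le> d"
    using G by (auto simp: bounded_degree_graphs_def simple_graph_def)
  have "e \<subseteq> verts G \<and> card e = 2" if e_in: "e \<in> cycle_edges xs" for e
  proof -
    obtain i where i: "i < length xs" and j: "(i + 1) mod length xs < length xs"
      and e: "e = {xs ! i, xs ! ((i + 1) mod length xs)}"
      using e_in by (rule cycle_edgesE)
    have "(i + 1) mod length xs \<noteq> i"
      using i xs(3) by (cases "i + 1 = length xs") auto
    then have "xs ! i \<noteq> xs ! ((i + 1) mod length xs)"
      by (metis nth_eq_iff_index_eq[OF xs(1) i j])
    then have "card e = 2" by (simp only: e card_2_iff) blast
    then show ?thesis using cycle_edges_subset[OF e_in] xs(2) by simp
  qed
  then have "simple_graph ?H" using sG by (auto simp: simple_graph_def)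
  moreover have "degree ?H v \<le> d + 2" if "v \<in> verts G" for v
  proof -
    have "{w \<in> verts G. {v, w} \<in> edges G \<union> cycle_edges xs} =
        {w \<in> verts G. {v, w} \<in> edges G} \<union> {w \<in> verts G. {v, w} \<in> cycle_edges xs}" by auto
    then have "degree ?H v \<le> degree G v + card {w \<in> verts G. {v, w} \<in> cycle_edges xs}"
      unfolding degree_def by (simp add: card_Un_le)
    also have "card {w \<in> verts G. {v, w} \<in> cycle_edges xs} \<le> card {w. {v, w} \<in> cycle_edges xs}"
    proof (rule card_mono)
      have "{w. {v, w} \<in> cycle_edges xs} \<subseteq> verts G"
        using \<open>\<And>e. e \<in> cycle_edges xs \<Longrightarrow> e \<subseteq> verts G \<and> card e = 2\<close> by blast
      then show "finite {w. {v, w} \<in> cycle_edges xs}" using sG(1) finite_subset by blast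
    qed auto
    also have "\<dots> \<le> 2" by (rule card_cycle_neighbours[OF xs(1)])
    finally show ?thesis using dG[OF that] by simp
  qed
  ultimately show ?thesis by (auto simp: bounded_degree_graphs_def)
qed

lemma hamiltonian_supergraph_of_cycle:
  assumes "distinct xs" "3 \<le> length xs"
  shows "hamiltonian \<lparr>verts = set xs, edges = E \<union> cycle_edges xs\<rparr>"
  unfolding hamiltonian_def is_cycle_def
  using assms by (intro exI[of _ xs]) (auto simp: cycle_edges_def)

text \<open>The witness is \<open>G\<close> with the cycle \<open>xs\<close> added, with
  \<open>T = S\<close> and the identity map. A new edge avoids \<open>S\<close>, so the closed
  neighbourhood is unchanged, and does not lie inside it, so the induced graph is unchanged.\<close>

lemma locally_hamiltonian_witness:
  fixes G :: "'a ugraph"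
  defines "N \<equiv> closed_nbhd G"
  assumes G: "G \<in> bounded_degree_graphs d" and S: "S \<subseteq> verts G"
    and xs: "distinct xs" "set xs = verts G" "3 \<le> length xs"
    and steps: "\<And>i. i < length xs \<Longrightarrow>
      (let x = xs ! i; y = xs ! ((i + 1) mod length xs) in
        {x, y} \<in> edges G \<or> x \<notin> S \<and> y \<notin> S \<and> (x \<notin> N S \<or> y \<notin> N S))"
  shows "\<exists>H\<in>(bounded_degree_graphs (d + 2) :: 'a ugraph set). hamiltonian H \<and> card (verts H) = card (verts G) \<and>
           (\<exists>T f. T \<subseteq> verts H \<and>
              graph_iso f (induced G (closed_nbhd G S)) (induced H (closed_nbhd H T)) \<and>
              f ` S = T)"
proof -
  define H where "H = \<lparr>verts = verts G, edges = edges G \<union> cycle_edges xs\<rparr>"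
  have new: "e \<in> edges G \<or> (e \<inter> S = {} \<and> \<not> e \<subseteq> N S)" if "e \<in> cycle_edges xs" for e
    using that steps by (auto simp: cycle_edges_def Let_def)
  have nb: "closed_nbhd H S = N S"
    using new unfolding closed_nbhd_def N_def H_def by auto
  have "induced H (closed_nbhd H S) = induced G (closed_nbhd G S)"
    unfolding nb unfolding induced_def N_def[symmetric] using new by (auto simp: H_def)
  then have "graph_iso id (induced G (closed_nbhd G S)) (induced H (closed_nbhd H S))"
    by (simp add: graph_iso_def)
  moreover have "H \<in> bounded_degree_graphs (d + 2)"
    unfolding H_def by (rule bounded_degree_add_cycle[OF G xs])
  moreover have "hamiltonian H"
    using hamiltonian_supergraph_of_cycle[OF xs(1,3)] by (simp add: H_def xs(2))
  moreover have "verts H = verts G" by (simp add: H_def)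
  moreover have "id ` S = S" by simp
  ultimately show ?thesis using S by metis
qed

text \<open>Links \<open>successively\<close>, which suits concatenated lists, to the indices of
  \<open>is_cycle\<close>; the repeated head supplies the closing step.\<close>

lemma successively_closed_imp_cyclic:
  assumes "successively R (xs @ [hd xs])" "i < length xs"
  shows "R (xs ! i) (xs ! ((i + 1) mod length xs))"
proof -
  have nth: "R (ys ! i) (ys ! Suc i)" if "successively R ys" "Suc i < length ys" for ys i
    using that by (induction R ys arbitrary: i rule: successively.induct)
      (auto simp: nth_Cons split: nat.splits)
  have *: "R ((xs @ [hd xs]) ! i) ((xs @ [hd xs]) ! Suc i)"
    by (rule nth) (use assms in auto)
  show ?thesis
  proof (cases "Suc i = length xs")
    case True
    have "xs \<noteq> []" using assms(2) by auto
    then show ?thesis using * True by (simp add: nth_append hd_conv_nth)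
  next
    case False
    then show ?thesis using * assms by (simp add: nth_append)
  qed
qed

lemma card_closed_nbhd_le:
  assumes "G \<in> bounded_degree_graphs d" "S \<subseteq> verts G"
  shows "card (closed_nbhd G S) \<le> (d + 1) * card S"
proof -
  have fin: "finite S"
    using assms finite_subset by (auto simp: bounded_degree_graphs_def simple_graph_def)
  have "closed_nbhd G S = S \<union> (\<Union>w\<in>S. {v \<in> verts G. {w, v} \<in> edges G})"
    by (auto simp: closed_nbhd_def insert_commute)
  then have "card (closed_nbhd G S) \<le> card S + card (\<Union>w\<in>S. {v \<in> verts G. {w, v} \<in> edges G})"
    by (simp add: card_Un_le)
  also have "card (\<Union>w\<in>S. {v \<in> verts G. {w, v} \<in> edges G}) \<le> (\<Sum>w\<in>S. degree G w)"
    unfolding degree_def by (rule card_UN_le[OF fin])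
  also have "\<dots> \<le> card S * d"
    using sum_bounded_above[of S "degree G" d] assms by (auto simp: bounded_degree_graphs_def)
  finally show ?thesis by (simp add: algebra_simps)
qed

section \<open>Large independent sets\<close>

lemma inj_on_Suc_mod: "inj_on (\<lambda>i. (i + 1) mod L) {..<L::nat}"
proof (rule inj_onI)
  fix i j assume "i \<in> {..<L}" "j \<in> {..<L}" "(i + 1) mod L = (j + 1) mod L"
  then show "i = j"
    by (cases "i + 1 = L"; cases "j + 1 = L") auto
qed

text \<open>On a cycle of length \<open>L\<close>, the positions in \<open>I\<close> and the
  positions followed by \<open>I\<close> number \<open>2 * card I\<close> together, so at least
  \<open>2 * card I - L\<close> cycle edges run inside \<open>I\<close>. All of them must come from
  \<open>E\<close>.\<close>

lemma far_from_hamiltonian_independent: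
  assumes G: "G \<in> bounded_degree_graphs d" and I: "I \<subseteq> verts G"
    and indep: "\<And>e. e \<in> edges G \<Longrightarrow> \<not> e \<subseteq> I"
    and gap: "\<epsilon> * real d * real (card (verts G)) < 2 * real (card I) - real (card (verts G))"
  shows "far_from_hamiltonian \<epsilon> d G"
  unfolding far_from_hamiltonian_def
proof (intro conjI allI impI G notI)
  fix E assume E: "E \<subseteq> {e. e \<subseteq> verts G \<and> card e = 2}"
    and small: "real (card E) \<le> \<epsilon> * real d * real (card (verts G))"
    and ham: "hamiltonian \<lparr>verts = verts G, edges = sym_diff (edges G) E\<rparr>"
  have finV: "finite (verts G)" using G by (simp add: bounded_degree_graphs_def simple_graph_def)
  then have finE: "finite E" using E finite_subset[of E "Pow (verts G)"] by auto
  obtain xs where xs: "distinct xs" "3 \<le> length xs" "set xs = verts G"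
    and edge: "\<And>i. i < length xs \<Longrightarrow> {xs ! i, xs ! ((i + 1) mod length xs)} \<in> sym_diff (edges G) E"
    using ham by (auto simp: hamiltonian_def is_cycle_def)
  define L where "L = length xs"
  define s where "s i = (i + 1) mod L" for i
  have L: "3 \<le> L" "L = card (verts G)" using xs distinct_card by (fastforce simp: L_def)+
  have s_less: "s i < L" for i using L by (simp add: s_def)
  have s_inj: "inj_on s {..<L}" unfolding s_def by (rule inj_on_Suc_mod)
  have s_img: "s ` {..<L} = {..<L}"
    using s_less by (intro endo_inj_surj s_inj) auto
  have nth_inj: "inj_on ((!) xs) {..<L}" using xs by (simp add: L_def inj_on_nth)
  have nth_img: "(!) xs ` {..<L} = verts G" using xs by (auto simp: L_def set_conv_nth)
  define X where "X = {i. i < L \<and> xs ! i \<in> I}"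
  define Y where "Y = {i. i < L \<and> xs ! s i \<in> I}"
  have "(!) xs ` X = I"
    using nth_img I by (auto simp: X_def image_iff)
  moreover have "inj_on ((!) xs) X" by (rule inj_on_subset[OF nth_inj]) (auto simp: X_def)
  ultimately have cX: "card X = card I" by (metis card_image)
  \<comment> \<open>The cyclic shift \<open>s\<close> is a bijection, so counting successors in
    \<open>I\<close> again gives \<open>card I\<close>.\<close>
  have "s ` Y = X"
  proof
    show "X \<subseteq> s ` Y"
    proof
      fix i assume i: "i \<in> X"
      then have "i \<in> s ` {..<L}" using s_img by (simp add: X_def)
      then show "i \<in> s ` Y" using i by (auto simp: X_def Y_def)
    qed
  qed (auto simp: X_def Y_def s_less)
  moreover have "inj_on s Y" by (rule inj_on_subset[OF s_inj]) (auto simp: Y_def)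
  ultimately have cY: "card Y = card I" using cX by (metis card_image)
  have fin: "finite X" "finite Y" by (auto simp: X_def Y_def)
  have "card (X \<union> Y) \<le> L"
    using card_mono[of "{..<L}" "X \<union> Y"] by (auto simp: X_def Y_def)
  then have "2 * card I \<le> L + card (X \<inter> Y)"
    using card_Un_Int[OF fin] cX cY by simp
  also have "card (X \<inter> Y) \<le> card E"
  proof (rule card_inj_on_le[OF _ _ finE])
    show "(\<lambda>i. {xs ! i, xs ! s i}) ` (X \<inter> Y) \<subseteq> E"
    proof
      fix e assume "e \<in> (\<lambda>i. {xs ! i, xs ! s i}) ` (X \<inter> Y)"
      then obtain i where i: "i < L" "xs ! i \<in> I" "xs ! s i \<in> I" "e = {xs ! i, xs ! s i}"
        by (auto simp: X_def Y_def)
      have "e \<notin> edges G" using i indep[of e] by auto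
      then show "e \<in> E" using edge[of i] i by (auto simp: L_def s_def)
    qed
    show "inj_on (\<lambda>i. {xs ! i, xs ! s i}) (X \<inter> Y)"
    proof (rule inj_onI)
      fix i j assume ij: "i \<in> X \<inter> Y" "j \<in> X \<inter> Y" "{xs ! i, xs ! s i} = {xs ! j, xs ! s j}"
      then have lt: "i < L" "j < L" by (auto simp: X_def)
      have eq: "xs ! k = xs ! l \<longleftrightarrow> k = l" if "k < L" "l < L" for k l
        using that xs(1) by (simp add: L_def nth_eq_iff_index_eq)
      have "i = j \<or> i = s j \<and> s i = j"
        using ij(3) by (auto simp: doubleton_eq_iff eq lt s_less)
      then show "i = j"
      proof
        \<comment> \<open>Two positions that succeed each other would need a cycle of length at most
          two.\<close>
        assume sw: "i = s j \<and> s i = j"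
        then show ?thesis using lt L(1)
          by (cases "i + 1 = L"; cases "j + 1 = L") (auto simp: s_def)
      qed
    qed
  qed
  finally have "2 * real (card I) \<le> real (card (verts G)) + real (card E)"
    using L(2) by linarith
  then show False using gap small by linarith
qed

section \<open>Insertion graphs\<close>

text \<open>Slot \<open>k\<close> is the rim edge from \<open>k\<close> to \<open>k + 1\<close> (cyclically), and \<open>Q a\<close> is the set of
  slots into which the vertex \<open>a\<close> can be inserted.\<close>

definition insertion_graph :: "nat \<Rightarrow> nat \<Rightarrow> (nat \<Rightarrow> nat set) \<Rightarrow> nat ugraph" where
  "insertion_graph m n Q = \<lparr>verts = {..<n},
     edges = {{k, (k + 1) mod m} | k. k < m} \<union>
             {{a, b} | a b. a \<in> {m..<n} \<and> (\<exists>k\<in>Q a. b = k \<or> b = (k + 1) mod m)}\<rparr>"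

context
  fixes m n :: nat and Q :: "nat \<Rightarrow> nat set"
  assumes m3: "3 \<le> m" and mn: "m \<le> n" and Q: "\<And>a. a \<in> {m..<n} \<Longrightarrow> Q a \<subseteq> {..<m}"
begin

lemma insertion_graph_verts: "verts (insertion_graph m n Q) = {..<n}"
  by (simp add: insertion_graph_def)

lemma insertion_graph_rim: "k < m \<Longrightarrow> {k, (k + 1) mod m} \<in> edges (insertion_graph m n Q)"
  by (auto simp: insertion_graph_def)

lemma insertion_graph_spoke:
  assumes "a \<in> {m..<n}" "k \<in> Q a"
  shows "{k, a} \<in> edges (insertion_graph m n Q)" "{a, (k + 1) mod m} \<in> edges (insertion_graph m n Q)"
proof -
  have "{a, k} \<in> edges (insertion_graph m n Q)" "{a, (k + 1) mod m} \<in> edges (insertion_graph m n Q)"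
    unfolding insertion_graph_def using assms by auto
  then show "{k, a} \<in> edges (insertion_graph m n Q)" "{a, (k + 1) mod m} \<in> edges (insertion_graph m n Q)"
    by (simp_all add: insert_commute)
qed

text \<open>Beyond unfolding, this records that rim edges have distinct ends and that every other
  edge has exactly one end on the rim; simplicity, independence and the degree count rest on
  it.\<close>

lemma insertion_graph_edgeE:
  assumes "e \<in> edges (insertion_graph m n Q)"
  obtains k where "k < m" "(k + 1) mod m < m" "k \<noteq> (k + 1) mod m" "e = {k, (k + 1) mod m}"
  | a k b where "a \<in> {m..<n}" "k \<in> Q a" "k < m" "b < m" "b = k \<or> b = (k + 1) mod m" "e = {a, b}"
proof -
  have less: "(k + 1) mod m < m" for k using m3 by simp
  consider k where "k < m" "e = {k, (k + 1) mod m}"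
    | a k b where "a \<in> {m..<n}" "k \<in> Q a" "b = k \<or> b = (k + 1) mod m" "e = {a, b}"
    using assms unfolding insertion_graph_def by auto
  then show ?thesis
  proof cases
    case (1 k)
    have "k \<noteq> (k + 1) mod m" using 1 m3 by (cases "k + 1 = m") auto
    then show ?thesis using that(1) 1 less by blast
  next
    case (2 a k b)
    then have "k < m" using Q by blast
    then show ?thesis using that(2)[OF 2(1,2) _ _ 2(3,4)] less 2(3) by blast
  qed
qed

lemma insertion_graph_independent:
  assumes "e \<in> edges (insertion_graph m n Q)"
  shows "\<not> e \<subseteq> {m..<n}"
  using assms by (rule insertion_graph_edgeE) auto

lemma insertion_graph_bounded_degree:
  assumes D: "\<And>a. a \<in> {m..<n} \<Longrightarrow> card (Q a) \<le> D"
    and R: "\<And>k. k < m \<Longrightarrow> card {a \<in> {m..<n}. k \<in> Q a} \<le> R"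
    and d: "2 * D \<le> d" "2 + 2 * R \<le> d"
  shows "insertion_graph m n Q \<in> bounded_degree_graphs d" (is "?G \<in> _")
proof -
  have "e \<subseteq> {..<n} \<and> card e = 2" if "e \<in> edges ?G" for e
    using that
  proof (rule insertion_graph_edgeE)
    fix k assume k: "k < m" "(k + 1) mod m < m" "k \<noteq> (k + 1) mod m" "e = {k, (k + 1) mod m}"
    then have "k < n" "(k + 1) mod m < n" using mn by linarith+
    then show ?thesis using k(3) by (simp add: k(4))
  qed (use mn in auto)
  then have "simple_graph ?G" by (simp add: simple_graph_def insertion_graph_verts)
  moreover have "degree ?G v \<le> d" if v: "v \<in> verts ?G" for v
  proof (cases "v < m")
    case False
    then have va: "v \<in> {m..<n}" using v by (simp add: insertion_graph_verts)
    have "{w \<in> verts ?G. {v, w} \<in> edges ?G} \<subseteq> Q v \<union> (\<lambda>k. (k + 1) mod m) ` Q v"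
    proof
      fix w assume "w \<in> {w \<in> verts ?G. {v, w} \<in> edges ?G}"
      then have "{v, w} \<in> edges ?G" by simp
      then show "w \<in> Q v \<union> (\<lambda>k. (k + 1) mod m) ` Q v"
        by (rule insertion_graph_edgeE) (use False in \<open>auto simp: doubleton_eq_iff\<close>)
    qed
    moreover have fin: "finite (Q v)" using Q[OF va] finite_subset by blast
    ultimately have "degree ?G v \<le> card (Q v \<union> (\<lambda>k. (k + 1) mod m) ` Q v)"
      unfolding degree_def by (intro card_mono) auto
    also have "\<dots> \<le> card (Q v) + card ((\<lambda>k. (k + 1) mod m) ` Q v)" by (rule card_Un_le)
    also have "\<dots> \<le> card (Q v) + card (Q v)" using card_image_le[OF fin] by simp
    finally show ?thesis using D[OF va] d by linarith
  next
    case True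
    \<comment> \<open>Slots \<open>v\<close> and \<open>p\<close> are the two rim edges at
      \<open>v\<close>; the \<open>+ m\<close> handles \<open>v = 0\<close>.\<close>
    define p where "p = (v + m - 1) mod m"
    have p: "p < m" using m3 by (simp add: p_def)
    have pred: "k = p" if "k < m" "v = (k + 1) mod m" for k
      using that unfolding p_def by (cases "k + 1 = m") auto
    let ?A = "\<lambda>k. {a \<in> {m..<n}. k \<in> Q a}"
    have "{w \<in> verts ?G. {v, w} \<in> edges ?G} \<subseteq> {p, (v + 1) mod m} \<union> (?A v \<union> ?A p)"
    proof
      fix w assume "w \<in> {w \<in> verts ?G. {v, w} \<in> edges ?G}"
      then have "{v, w} \<in> edges ?G" by simp
      then show "w \<in> {p, (v + 1) mod m} \<union> (?A v \<union> ?A p)"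
        by (rule insertion_graph_edgeE) (use True pred in \<open>auto simp: doubleton_eq_iff\<close>)
    qed
    then have "degree ?G v \<le> card ({p, (v + 1) mod m} \<union> (?A v \<union> ?A p))"
      unfolding degree_def by (intro card_mono) auto
    also have "\<dots> \<le> card {p, (v + 1) mod m} + (card (?A v) + card (?A p))"
      by (meson card_Un_le add_left_mono order_trans)
    also have "card {p, (v + 1) mod m} \<le> 2" by (simp add: card_insert_if)
    finally show ?thesis using R[OF True] R[OF p] d by linarith
  qed
  ultimately show ?thesis by (simp add: bounded_degree_graphs_def)
qed

text \<open>\<open>(d + 1) * card S\<close> bounds the closed neighbourhood, so Hall's theorem
  places its inserted vertices along spokes of \<open>G\<close>. The other inserted vertices all
  enter at one slot \<open>i\<close>, and only there does the cycle use new edges.\<close>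

lemma insertion_graph_local_witness:
  fixes S :: "nat set"
  defines "G \<equiv> insertion_graph m n Q"
  assumes G: "G \<in> bounded_degree_graphs d" and S: "S \<subseteq> {..<n}"
    and expand: "\<And>X. X \<subseteq> {m..<n} \<Longrightarrow> card X \<le> (d + 1) * card S \<Longrightarrow> card X \<le> card (\<Union>(Q ` X))"
    and small: "(d + 3) * card S < m"
  shows "\<exists>H\<in>(bounded_degree_graphs (d + 2) :: nat ugraph set).
           hamiltonian H \<and> card (verts H) = card (verts G) \<and>
           (\<exists>T f. T \<subseteq> verts H \<and>
              graph_iso f (induced G (closed_nbhd G S)) (induced H (closed_nbhd H T)) \<and>
              f ` S = T)"
proof -
  define N where "N = closed_nbhd G S"
  define X where "X = N \<inter> {m..<n}"
  \<comment> \<open>\<open>R\<close> is the step condition of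
    \<open>locally_hamiltonian_witness\<close>.\<close>
  define R where "R x y \<longleftrightarrow> {x, y} \<in> edges G \<or> x \<notin> S \<and> y \<notin> S \<and> (x \<notin> N \<or> y \<notin> N)" for x y
  have V: "verts G = {..<n}" by (simp add: G_def insertion_graph_verts)
  have finS: "finite S" using S finite_subset by blast
  have SN: "S \<subseteq> N" by (auto simp: N_def closed_nbhd_def)
  have "N \<subseteq> {..<n}" using S V by (auto simp: N_def closed_nbhd_def)
  then have finN: "finite N" using finite_subset by blast
  have cN: "card N \<le> (d + 1) * card S"
    unfolding N_def using S by (intro card_closed_nbhd_le G) (simp add: V)
  have "card X \<le> card N" unfolding X_def by (intro card_mono finN) auto
  then have cX: "card X \<le> (d + 1) * card S" using cN by linarith
  have finX: "finite X" by (simp add: X_def)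
  have "\<exists>g. inj_on g X \<and> (\<forall>x\<in>X. g x \<in> Q x)"
  proof (rule hall_distinct_representatives[OF finX])
    show "finite (Q x)" if "x \<in> X" for x
      using Q[of x] that finite_subset by (auto simp: X_def)
    fix Y assume Y: "Y \<subseteq> X"
    then have "card Y \<le> card X" by (intro card_mono finX)
    then show "card Y \<le> card (\<Union>(Q ` Y))"
      using Y cX by (intro expand) (auto simp: X_def)
  qed
  then obtain g where g: "inj_on g X" "\<And>x. x \<in> X \<Longrightarrow> g x \<in> Q x" by blast
  \<comment> \<open>At most \<open>(d + 1) * card S\<close> slots are taken by \<open>g\<close>, and
    at most \<open>card S\<close> each start in \<open>S\<close> or end in \<open>S\<close>, so
    fewer than \<open>m\<close> slots are excluded.\<close>
  obtain i where i: "i < m" "i \<notin> g ` X" "i \<notin> S" "(i + 1) mod m \<notin> S"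
  proof -
    let ?Z = "{i. i < m \<and> (i + 1) mod m \<in> S}"
    have "card ?Z \<le> card S"
      by (rule card_inj_on_le[of "\<lambda>i. (i + 1) mod m", OF inj_on_subset[OF inj_on_Suc_mod[of m]]])
        (auto intro: finS)
    moreover have "card (g ` X \<union> S \<union> ?Z) \<le> card (g ` X) + card S + card ?Z"
      by (meson card_Un_le add_right_mono order_trans)
    moreover have "card (g ` X) \<le> card X" by (rule card_image_le[OF finX])
    moreover have "(d + 3) * card S = (d + 1) * card S + 2 * card S" by (simp add: algebra_simps)
    ultimately have "card (g ` X \<union> S \<union> ?Z) < card {..<m}"
      using cX small by simp
    then have "\<not> {..<m} \<subseteq> g ` X \<union> S \<union> ?Z"
      using card_mono[of "g ` X \<union> S \<union> ?Z" "{..<m}"] finX finS by auto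
    then show ?thesis using that by blast
  qed
  \<comment> \<open>Any order of these vertices works: all of them lie outside \<open>N\<close>, so
    \<open>R\<close> holds between any two.\<close>
  define rest where "rest = sorted_list_of_set ({m..<n} - N)"
  have rest: "set rest = {m..<n} - N" "distinct rest" by (auto simp: rest_def)
  define ins where "ins k = (if k = i then rest else if k \<in> g ` X then [inv_into X g k] else [])" for k
  define xs where "xs = concat (map (\<lambda>k. k # ins k) [0..<m])"
  have R_off: "R x y" if "x \<notin> S" "y \<notin> S" "x \<notin> N \<or> y \<notin> N" for x y
    using that by (simp add: R_def)
  have R_rim: "R k ((k + 1) mod m)" if "k < m" for k
    using insertion_graph_rim[OF that] by (simp add: R_def G_def)
  have all_R: "successively R ys" if "\<And>x y. x \<in> set ys \<Longrightarrow> y \<in> set ys \<Longrightarrow> R x y" for ys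
  proof (rule successively_if_sorted_wrt)
    show "sorted_wrt R ys" using that by (induction ys) auto
  qed
  \<comment> \<open>Each block is closed by the first vertex of the next one. Slot \<open>i\<close>
    uses steps with an end outside \<open>N\<close> and no end in \<open>S\<close>, a slot
    \<open>g x\<close> uses the spokes of \<open>x\<close>, and an empty slot keeps its rim
    edge.\<close>
  have block: "successively R (k # ins k @ [(k + 1) mod m])" if k: "k < m" for k
  proof -
    consider "k = i" "rest \<noteq> []" | x where "k \<noteq> i" "x \<in> X" "k = g x" | "ins k = []"
      by (cases "k = i"; cases "k \<in> g ` X"; cases "rest = []") (auto simp: ins_def)
    then show ?thesis
    proof cases
      case 1
      have off: "x \<notin> N" "x \<notin> S" if "x \<in> set rest" for x using that rest SN by auto
      have "successively R rest" by (intro all_R R_off) (auto simp: off)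
      moreover have "R i (hd rest)" "R (last rest) ((i + 1) mod m)"
        using 1 i by (auto intro!: R_off simp: off)
      ultimately show ?thesis
        using 1 by (simp add: ins_def successively_Cons successively_append_iff)
    next
      case 2
      then have "ins k = [x]" using g(1) by (auto simp: ins_def)
      moreover have "x \<in> {m..<n}" using 2 by (simp add: X_def)
      ultimately show ?thesis
        using insertion_graph_spoke[of x k] g(2)[OF 2(2)] 2(3) by (simp add: R_def G_def)
    qed (use R_rim[OF k] in simp)
  qed
  \<comment> \<open>\<open>[j mod m]\<close> is the start of the next block; for
    \<open>j = m\<close> it wraps around to \<open>0\<close>, the head of \<open>xs\<close>.\<close>
  have chain: "successively R (concat (map (\<lambda>k. k # ins k) [0..<j]) @ [j mod m])" if "j \<le> m" for j
    using that
  proof (induction j)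
    case (Suc j)
    let ?c = "concat (map (\<lambda>k. k # ins k) [0..<j])"
    have "successively R (?c @ [j])" using Suc by simp
    moreover have "successively R ((j # ins j) @ [(j + 1) mod m])" using block[of j] Suc.prems by simp
    ultimately have "successively R (?c @ ((j # ins j) @ [(j + 1) mod m]))"
      unfolding successively_append_iff[of _ ?c] by simp
    then show ?case by simp
  qed simp
  have "hd xs = 0" using m3 by (simp add: xs_def upt_conv_Cons)
  then have "successively R (xs @ [hd xs])" using chain[of m] by (simp add: xs_def)
  note steps = successively_closed_imp_cyclic[OF this]
  have ins_set: "set (ins k) = (if k = i then {m..<n} - N else {x \<in> X. g x = k})" for k
    using g(1) rest i(2) by (auto simp: ins_def inv_into_f_f)
  have X_set: "X \<subseteq> {m..<n}" "X \<subseteq> N" by (auto simp: X_def)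
  have ins_range: "set (ins k) \<subseteq> {m..<n}" for k using X_set by (auto simp: ins_set)
  have xs_set: "set xs = {..<n}"
  proof -
    have "(\<Union>k<m. set (ins k)) = {m..<n}"
    proof
      show "{m..<n} \<subseteq> (\<Union>k<m. set (ins k))"
      proof
        fix a assume a: "a \<in> {m..<n}"
        show "a \<in> (\<Union>k<m. set (ins k))"
        proof (cases "a \<in> N")
          case True
          then have "a \<in> X" using a by (simp add: X_def)
          moreover from this have "g a < m" using g(2) Q[OF a] by blast
          moreover have "g a \<noteq> i" using i(2) \<open>a \<in> X\<close> by blast
          ultimately show ?thesis by (intro UN_I[of "g a"]) (auto simp: ins_set)
        qed (use a i in \<open>auto intro!: UN_I[of i] simp: ins_set\<close>)
      qed
    qed (use ins_range in blast)
    moreover have "set xs = {..<m} \<union> (\<Union>k<m. set (ins k))" by (auto simp: xs_def)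
    ultimately show ?thesis using mn by auto
  qed
  have xs_dist: "distinct xs"
    unfolding xs_def
  proof (rule distinct_concat)
    show "distinct (map (\<lambda>k. k # ins k) [0..<m])" by (simp add: distinct_map inj_on_def)
    show "distinct ys" if ys: "ys \<in> set (map (\<lambda>k. k # ins k) [0..<m])" for ys
    proof -
      obtain k where k: "k < m" "ys = k # ins k" using ys by auto
      have "distinct (ins k)" using rest by (simp add: ins_def)
      then show ?thesis using k ins_range[of k] by auto
    qed
    show "set ys \<inter> set zs = {}"
      if yz: "ys \<in> set (map (\<lambda>k. k # ins k) [0..<m])" "zs \<in> set (map (\<lambda>k. k # ins k) [0..<m])" "ys \<noteq> zs"
      for ys zs
    proof -
      obtain k where k: "k < m" "ys = k # ins k" using yz(1) by auto
      obtain l where l: "l < m" "zs = l # ins l" using yz(2) by auto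
      have kl: "k \<noteq> l" using yz(3) k l by blast
      have "set (ins k) \<inter> set (ins l) = {}"
        using kl X_set(2) by (auto simp: ins_set)
      then show ?thesis using k l kl ins_range[of k] ins_range[of l] by auto
    qed
  qed
  have "length xs = n" using distinct_card[OF xs_dist] xs_set by simp
  then have "3 \<le> length xs" using m3 mn by simp
  moreover have "S \<subseteq> verts G" "set xs = verts G" using S xs_set V by auto
  ultimately show ?thesis
    using steps unfolding R_def N_def
    by (intro locally_hamiltonian_witness[OF G _ xs_dist]) (auto simp: Let_def)
qed

end

section \<open>Expanding permutations\<close>

text \<open>A bijection from \<open>Y\<close> to \<open>Z\<close> is completed by one between the
  complements in \<open>A\<close>, which have equal size, and by the identity outside
  \<open>A\<close>.\<close>

lemma ex_permutes_image_eq: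
  assumes "finite A" "Y \<subseteq> A" "Z \<subseteq> A" "card Y = card Z"
  obtains p where "p permutes A" "p ` Y = Z"
proof -
  have fin: "finite Y" "finite Z" using assms finite_subset by auto
  obtain f where f: "bij_betw f Y Z"
    using finite_same_card_bij[OF fin assms(4)] by blast
  have "card (A - Y) = card (A - Z)" using assms fin by (simp add: card_Diff_subset)
  then obtain g where g: "bij_betw g (A - Y) (A - Z)"
    using finite_same_card_bij assms(1) by (meson finite_Diff)
  define p where "p x = (if x \<in> Y then f x else if x \<in> A then g x else x)" for x
  have 1: "bij_betw p Y Z" using f by (simp add: p_def cong: bij_betw_cong)
  have 2: "bij_betw p (A - Y) (A - Z)"
    using g by (subst bij_betw_cong[of _ _ g]) (auto simp: p_def)
  have "bij_betw p (Y \<union> (A - Y)) (Z \<union> (A - Z))"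
    by (rule bij_betw_combine[OF 1 2]) auto
  then have "bij_betw p A A" using assms by (simp add: Un_absorb1)
  then have "p permutes A"
    by (rule bij_imp_permutes) (use assms in \<open>auto simp: p_def\<close>)
  moreover have "p ` Y = Z" using 1 by (simp add: bij_betw_def)
  ultimately show ?thesis using that by blast
qed

text \<open>Double counting of the pairs \<open>(Z, p)\<close> with \<open>card Z = card Y\<close> and \<open>p ` Z \<subseteq> T\<close>: the
  number of suitable \<open>p\<close> is the same for all \<open>Z\<close>.\<close>

lemma card_permutes_into:
  assumes "finite A" "Y \<subseteq> A" "T \<subseteq> A"
  shows "card {p. p permutes A \<and> p ` Y \<subseteq> T} * (card A choose card Y) =
         (card T choose card Y) * fact (card A)"
proof -
  define P where "P = {p. p permutes A}"
  define F where "F = {Z. Z \<subseteq> A \<and> card Z = card Y}"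
  define c where "c Z = card {p \<in> P. p ` Z \<subseteq> T}" for Z
  have finP: "finite P" using assms(1) by (simp add: P_def finite_permutations)
  have finF: "finite F" using assms(1) by (simp add: F_def)
  \<comment> \<open>Precomposing with a permutation that carries \<open>Z'\<close> to
    \<open>Z\<close> is injective; by symmetry \<open>c\<close> is constant on
    \<open>F\<close>.\<close>
  have le: "c Z \<le> c Z'" if "Z \<in> F" "Z' \<in> F" for Z Z'
  proof -
    have "Z' \<subseteq> A" "Z \<subseteq> A" "card Z' = card Z" using that by (auto simp: F_def)
    then obtain q where q: "q permutes A" "q ` Z' = Z"
      using ex_permutes_image_eq[OF assms(1)] by metis
    have "inj_on (\<lambda>p. p \<circ> q) {p \<in> P. p ` Z \<subseteq> T}"
      using permutes_surj[OF q(1)] by (auto simp: inj_on_def fun_eq_iff) (metis surj_def)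
    moreover have "(\<lambda>p. p \<circ> q) ` {p \<in> P. p ` Z \<subseteq> T} \<subseteq> {p \<in> P. p ` Z' \<subseteq> T}"
      using q by (auto simp: P_def permutes_compose)
    ultimately show ?thesis unfolding c_def using finP by (intro card_inj_on_le) auto
  qed
  have Y: "Y \<in> F" using assms by (simp add: F_def)
  \<comment> \<open>For fixed \<open>p\<close>, the sets counted are subsets of the preimage of
    \<open>T\<close>, which has as many elements as \<open>T\<close>.\<close>
  have "card {Z \<in> F. p ` Z \<subseteq> T} = card T choose card Y" if "p \<in> P" for p
  proof -
    have p: "p permutes A" using that by (simp add: P_def)
    have sub: "p -` T \<subseteq> A" using permutes_in_image[OF p] assms(3) by blast
    have "{Z \<in> F. p ` Z \<subseteq> T} = {Z. Z \<subseteq> p -` T \<and> card Z = card Y}"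
      using sub by (auto simp: F_def)
    also have "card \<dots> = card (p -` T) choose card Y"
      using sub assms(1) finite_subset by (intro n_subsets) blast
    also have "card (p -` T) = card T"
      using p by (metis card_vimage_inj permutes_inj permutes_surj subset_UNIV)
    finally show ?thesis .
  qed
  then have "(\<Sum>Z\<in>F. c Z) = (\<Sum>p\<in>P. card T choose card Y)"
    unfolding c_def using finP finF by (intro sum_multicount_gen) auto
  moreover have "(\<Sum>Z\<in>F. c Z) = (\<Sum>Z\<in>F. c Y)"
    using le Y by (intro sum.cong) (auto intro: antisym)
  moreover have "card F = card A choose card Y"
    unfolding F_def by (rule n_subsets[OF assms(1)])
  moreover have "card P = fact (card A)"
    unfolding P_def by (rule card_permutations[OF refl assms(1)])
  ultimately show ?thesis by (simp add: c_def P_def ac_simps)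
qed

text \<open>For \<open>s \<le> m\<close> the quotient of the binomial coefficients is a product of
  factors \<open>(t - i) / (m - i)\<close>, each at most \<open>t / m\<close>. Denominators are
  cleared to stay in the naturals.\<close>

lemma choose_mult_power_le:
  fixes t m s :: nat
  assumes "t \<le> m"
  shows "(t choose s) * m ^ s \<le> (m choose s) * t ^ s"
proof (induction s)
  case (Suc s)
  have step: "Suc s * (n choose Suc s) = (n - s) * (n choose s)" for n
    by (simp only: binomial_absorb_comp binomial_absorption)
  have "(t - s) * m \<le> (m - s) * t"
    using assms mult_le_mono2[OF assms, of s]
    by (simp add: diff_mult_distrib mult.commute[of t] diff_le_mono2)
  then have "((t choose s) * m ^ s) * ((t - s) * m) \<le> ((m choose s) * t ^ s) * ((m - s) * t)"
    by (rule mult_le_mono[OF Suc.IH])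
  moreover have "((n choose s) * x ^ s) * ((n - s) * x) = Suc s * ((n choose Suc s) * x ^ Suc s)"
    for n x :: nat
  proof -
    have "((n choose s) * x ^ s) * ((n - s) * x) = ((n - s) * (n choose s)) * (x * x ^ s)"
      by (simp only: ac_simps)
    also have "\<dots> = Suc s * (n choose Suc s) * (x * x ^ s)" by (simp only: step)
    finally show ?thesis by (simp only: power_Suc ac_simps)
  qed
  ultimately show ?case by (metis Suc_mult_le_cancel1)
qed simp

text \<open>Under a random permutation the points of \<open>Y\<close> are no likelier to land all in
  \<open>T\<close> than under independent uniform choices: the exact count is combined with
  \<open>choose_mult_power_le\<close>.\<close>

lemma card_permutes_into_le:
  assumes "finite A" "Y \<subseteq> A" "T \<subseteq> A"
  shows "card {p. p permutes A \<and> p ` Y \<subseteq> T} * card A ^ card Y \<le> card T ^ card Y * fact (card A)"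
    (is "?c * _ \<le> _")
proof -
  let ?m = "card A" and ?s = "card Y" and ?t = "card T"
  have pos: "0 < (?m choose ?s)" using assms by (simp add: card_mono)
  have "(?m choose ?s) * (?c * ?m ^ ?s) = (?c * (?m choose ?s)) * ?m ^ ?s" by simp
  also have "\<dots> = ((?t choose ?s) * ?m ^ ?s) * fact ?m"
    by (subst card_permutes_into[OF assms]) simp
  also have "\<dots> \<le> ((?m choose ?s) * ?t ^ ?s) * fact ?m"
    using assms by (intro mult_right_mono choose_mult_power_le card_mono) auto
  finally have "(?m choose ?s) * (?c * ?m ^ ?s) \<le> (?m choose ?s) * (?t ^ ?s * fact ?m)"
    by (simp only: mult.assoc)
  then show ?thesis using pos by (simp only: nat_mult_le_cancel1)
qed

text \<open>\<open>k ^ k / fact k\<close> is one term of the series of \<open>exp k\<close>, and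
  \<open>exp 1 \<le> 3\<close>.\<close>

lemma power_self_le_fact: "real k ^ k \<le> 3 ^ k * fact k"
proof -
  have "(\<lambda>n. real k ^ n /\<^sub>R fact n) sums exp (real k)" by (rule exp_converges)
  then have "real k ^ k /\<^sub>R fact k \<le> exp (real k)"
    using sum_le_suminf[of "\<lambda>n. real k ^ n /\<^sub>R fact n" "{k}"]
    by (auto simp: sums_iff)
  also have "exp (real k) = exp 1 ^ k" by (simp flip: exp_of_nat_mult)
  also have "\<dots> \<le> 3 ^ k" by (intro power_mono exp_le) auto
  finally show ?thesis by (simp add: field_simps)
qed

text \<open>The usual bound with base \<open>e * n / k\<close>, where \<open>e\<close> is rounded up
  to 3; it starts from \<open>n ^ k / fact k\<close>.\<close>

lemma choose_le_power:
  assumes "0 < k"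
  shows "real (n choose k) \<le> (3 * real n / real k) ^ k"
proof -
  have "real (n choose k) * real k ^ k \<le> real (n choose k) * (3 ^ k * fact k)"
    by (intro mult_left_mono power_self_le_fact) auto
  also have "\<dots> = 3 ^ k * real ((n choose k) * fact k)" by simp
  also have "\<dots> \<le> 3 ^ k * real (n ^ k)"
    by (intro mult_left_mono of_nat_mono binomial_fact_pow) auto
  finally show ?thesis using assms by (simp add: field_simps)
qed

text \<open>Union bound over quadruples of permutations: a bad one has some \<open>Y\<close> of size
  \<open>s\<close> whose four images all lie in a set \<open>T\<close> of size \<open>2 * s\<close>.
  Fewer than \<open>fact m ^ 4\<close> quadruples are bad, so a good one exists.\<close>

lemma ex_expanding_permutations:
  fixes m :: nat
  obtains P :: "nat \<Rightarrow> nat \<Rightarrow> nat"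
  where "\<And>j. j < 4 \<Longrightarrow> P j permutes {..<m}"
    and "\<And>Y. Y \<subseteq> {..<m} \<Longrightarrow> 400 * card Y \<le> m \<Longrightarrow> 2 * card Y \<le> card (\<Union>j<4. P j ` Y)"
proof -
  define A where "A = {..<m}"
  \<comment> \<open>Extensional functions on the four indices make the quadruples finite in number,
    with \<open>card\<close> a fourth power.\<close>
  define W where "W = {..<4::nat} \<rightarrow>\<^sub>E {p. p permutes A}"
  define B where "B Y T = {..<4::nat} \<rightarrow>\<^sub>E {p. p permutes A \<and> p ` Y \<subseteq> T}" for Y T
  define F where "F k = {Y. Y \<subseteq> A \<and> card Y = k}" for k
  have A: "finite A" "card A = m" by (auto simp: A_def)
  have finF: "finite (F k)" for k using A by (simp add: F_def)
  have cardF: "card (F k) = m choose k" for k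
    using n_subsets[OF A(1), of k] A(2) by (simp add: F_def)
  have finB: "finite (B Y T)" for Y T
    unfolding B_def using finite_permutations[OF A(1)] by (intro finite_PiE) auto
  have cardW: "card W = fact m ^ 4"
    by (simp add: W_def card_funcsetE card_permutations[OF refl A(1)] A)
  have cardB: "real (card (B Y T)) \<le> (2 * real s / real m) ^ (4 * s) * fact m ^ 4"
    if "Y \<in> F s" "T \<in> F (2 * s)" "0 < s" "400 * s \<le> m" for Y T s
  proof -
    let ?c = "card {p. p permutes A \<and> p ` Y \<subseteq> T}"
    have "?c * m ^ s \<le> (2 * s) ^ s * fact m"
      using card_permutes_into_le[OF A(1), of Y T] that by (simp add: F_def A)
    then have "real (?c * m ^ s) \<le> real ((2 * s) ^ s * fact m)" by (rule of_nat_mono)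
    then have "real ?c \<le> (2 * real s / real m) ^ s * fact m"
      using that by (simp add: field_simps)
    then have "real ?c ^ 4 \<le> ((2 * real s / real m) ^ s * fact m) ^ 4"
      by (intro power_mono) auto
    then show ?thesis
      by (simp add: B_def card_funcsetE power_mult_distrib power_mult[symmetric] mult.commute)
  qed
  define M where "M = m div 400"
  define Bad where "Bad = (\<Union>s\<in>{1..M}. \<Union>Y\<in>F s. \<Union>T\<in>F (2 * s). B Y T)"
  have "real (card Bad) \<le> (\<Sum>s\<in>{1..M}. (1 / 3) ^ s * fact m ^ 4)"
  proof -
    have "real (card Bad) \<le> (\<Sum>s\<in>{1..M}. real (card (\<Union>Y\<in>F s. \<Union>T\<in>F (2 * s). B Y T)))"
      unfolding Bad_def of_nat_sum[symmetric] by (intro of_nat_mono card_UN_le) auto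
    also have "\<dots> \<le> (\<Sum>s\<in>{1..M}. (1 / 3) ^ s * fact m ^ 4)"
    proof (rule sum_mono)
      fix s assume "s \<in> {1..M}"
      then have s: "0 < s" "400 * s \<le> m" by (auto simp: M_def)
      let ?x = "(2 * real s / real m) ^ (4 * s) * fact m ^ 4"
      have "real (card (\<Union>Y\<in>F s. \<Union>T\<in>F (2 * s). B Y T)) \<le>
          (\<Sum>Y\<in>F s. real (card (\<Union>T\<in>F (2 * s). B Y T)))"
        unfolding of_nat_sum[symmetric] by (intro of_nat_mono card_UN_le finF)
      also have "\<dots> \<le> (\<Sum>Y\<in>F s. \<Sum>T\<in>F (2 * s). real (card (B Y T)))"
        unfolding of_nat_sum[symmetric] by (intro sum_mono of_nat_mono card_UN_le finF)
      also have "\<dots> \<le> (\<Sum>Y\<in>F s. \<Sum>T\<in>F (2 * s). ?x)"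
        by (intro sum_mono cardB s) auto
      also have "\<dots> = real (m choose s) * real (m choose (2 * s)) * ?x"
        by (simp add: cardF)
      also have "\<dots> \<le> (3 * real m / real s) ^ s * (3 * real m / real (2 * s)) ^ (2 * s) * ?x"
        using s by (intro mult_right_mono mult_mono choose_le_power) auto
      \<comment> \<open>Up to constants in the base, the binomial coefficients contribute
        \<open>(m / s) ^ (3 * s)\<close> and the permutations \<open>(s / m) ^ (4 * s)\<close>, so
        one factor \<open>s / m\<close> survives in the base.\<close>
      also have "\<dots> = ((3 * real m / real s) * (3 * real m / real (2 * s))\<^sup>2 * (2 * real s / real m) ^ 4) ^ s
          * fact m ^ 4"
        by (simp only: power_mult_distrib power_mult[symmetric] mult.assoc)
      also have "(3 * real m / real s) * (3 * real m / real (2 * s))\<^sup>2 * (2 * real s / real m) ^ 4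
          = 108 * real s / real m"
        using s by (simp add: field_simps power2_eq_square power4_eq_xxxx)
      \<comment> \<open>From \<open>400 * s \<le> m\<close> the base is at most 108/400, which is
        below 1/3; this is where 400 comes from.\<close>
      also have "(108 * real s / real m) ^ s * fact m ^ 4 \<le> (1 / 3) ^ s * fact m ^ 4"
        using s by (intro mult_right_mono power_mono) (auto simp: field_simps)
      finally show "real (card (\<Union>Y\<in>F s. \<Union>T\<in>F (2 * s). B Y T)) \<le> (1 / 3) ^ s * fact m ^ 4" .
    qed
    finally show ?thesis .
  qed
  also have "\<dots> = (\<Sum>s\<in>{1..M}. (1 / 3) ^ s) * fact m ^ 4"
    by (simp add: sum_distrib_right)
  also have "\<dots> < 1 * fact m ^ 4"
  proof (rule mult_strict_right_mono)
    have geo: "(\<Sum>s\<in>{1..n}. q ^ s) = (1 - q ^ n) / 2" if "q = 1 / 3" for q :: real and n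
    proof (induction n)
      case (Suc n)
      have "q * q ^ n = q ^ n / 3" by (simp add: that)
      with Suc.IH have "(\<Sum>s\<in>{1..n}. q ^ s) + q * q ^ n = (1 - q * q ^ n) / 2" by argo
      then show ?case by simp
    qed simp
    have "0 < (1 / 3 :: real) ^ M" by simp
    then show "(\<Sum>s\<in>{1..M}. (1 / 3 :: real) ^ s) < 1"
      unfolding geo[OF refl] by argo
  qed auto
  also have "\<dots> = real (card W)" by (simp add: cardW)
  finally have "card Bad < card W" by simp
  moreover have "finite Bad" using finB finF by (auto simp: Bad_def)
  ultimately obtain P where P: "P \<in> W" "P \<notin> Bad"
    by (meson card_mono not_less subsetI)
  have perm: "P j permutes {..<m}" if "j < 4" for j
    using P(1) that by (auto simp: W_def A_def PiE_iff)
  moreover have "2 * card Y \<le> card (\<Union>j<4. P j ` Y)" if Y: "Y \<subseteq> {..<m}" "400 * card Y \<le> m" for Y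
  proof (rule ccontr)
    let ?U = "\<Union>j<4. P j ` Y"
    assume less: "\<not> 2 * card Y \<le> card ?U"
    \<comment> \<open>The failed inequality rules out \<open>Y = {}\<close>, so
      \<open>card Y\<close> is at least 1.\<close>
    then have s: "card Y \<in> {1..M}" using Y by (auto simp: M_def)
    have U: "?U \<subseteq> A" using Y perm unfolding A_def by (auto dest: permutes_in_image)
    \<comment> \<open>\<open>Bad\<close> speaks of sets of size exactly \<open>2 * card Y\<close>,
      so the union is padded; \<open>A\<close> is large enough for that.\<close>
    have "\<exists>T. ?U \<subseteq> T \<and> T \<subseteq> A \<and> card T = 2 * card Y"
      using less s U A by (intro exists_subset_between) (auto simp: M_def)
    then obtain T where T: "?U \<subseteq> T" "T \<subseteq> A" "card T = 2 * card Y" by blast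
    have "P \<in> B Y T" using P(1) T(1) unfolding W_def B_def PiE_iff by blast
    then have "P \<in> Bad" using s T Y unfolding Bad_def F_def A_def by blast
    then show False using P by blast
  qed
  ultimately show ?thesis using that by blast
qed

section \<open>The graph family\<close>

lemma bounded_degree_graphs_mono: "d \<le> d' \<Longrightarrow> bounded_degree_graphs d \<subseteq> bounded_degree_graphs d'"
  by (fastforce simp: bounded_degree_graphs_def)

lemma ex_locally_hamiltonian_far_from_hamiltonian:
  assumes m3: "3 \<le> m"
  obtains G :: "nat ugraph" where "card (verts G) = 3 * m" "G \<in> bounded_degree_graphs 20"
    "locally_hamiltonian (1 / 30000) (bounded_degree_graphs 20) G" "far_from_hamiltonian (1 / 100) 20 G"
proof -
  obtain P :: "nat \<Rightarrow> nat \<Rightarrow> nat" where perm: "\<And>j. j < 4 \<Longrightarrow> P j permutes {..<m}"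
    and expand: "\<And>Y. Y \<subseteq> {..<m} \<Longrightarrow> 400 * card Y \<le> m \<Longrightarrow> 2 * card Y \<le> card (\<Union>j<4. P j ` Y)"
    using ex_expanding_permutations[of m] by metis
  \<comment> \<open>For \<open>r < m\<close> the vertices \<open>r + m\<close> and
    \<open>r + 2 * m\<close> share the slots \<open>P j r\<close>; expansion by the factor two pays
    for this doubling.\<close>
  define Q where "Q a = (\<lambda>j. P j (a mod m)) ` {..<4}" for a
  define G where "G = insertion_graph m (3 * m) Q"
  have pos: "0 < m" and mn: "m \<le> 3 * m" using m3 by auto
  have Q: "Q a \<subseteq> {..<m}" for a
    using permutes_in_image[OF perm] pos by (fastforce simp: Q_def)
  note facts = m3 mn Q
  have two_copies: "a = a mod m + m \<or> a = a mod m + 2 * m" if "m \<le> a" "a < 3 * m" for a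
  proof -
    have "1 \<le> a div m" using div_le_mono[OF that(1), of m] pos by simp
    moreover have "a div m < 3" using that(2) by (simp add: less_mult_imp_div_less)
    ultimately have "a div m = 1 \<or> a div m = 2" by linarith
    then show ?thesis using mod_div_mult_eq[of a m] by (metis mult_1)
  qed
  have verts: "verts G = {..<3 * m}" by (simp add: G_def insertion_graph_def)
  have deg18: "G \<in> bounded_degree_graphs 18"
    unfolding G_def
  \<comment> \<open>Each of the four permutations sends one residue to \<open>k\<close>, and each
    residue has two vertices. Hence \<open>R = 8\<close>, and \<open>2 + 2 * 8 = 18\<close>.\<close>
  proof (rule insertion_graph_bounded_degree[OF facts, where D = 4 and R = 8])
    show "card (Q a) \<le> 4" for a
      unfolding Q_def using card_image_le[of "{..<4::nat}"] by (metis card_lessThan finite_lessThan)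
    fix k assume "k < m"
    have "{a \<in> {m..<3 * m}. k \<in> Q a} \<subseteq> (\<Union>j<4. {inv (P j) k + m, inv (P j) k + 2 * m})"
    proof
      fix a assume "a \<in> {a \<in> {m..<3 * m}. k \<in> Q a}"
      then obtain j where a: "m \<le> a" "a < 3 * m" and j: "j < 4" "k = P j (a mod m)"
        by (auto simp: Q_def)
      have "inv (P j) k = a mod m" using permutes_inverses(2)[OF perm[OF j(1)]] j(2) by simp
      moreover have "a = a mod m + m \<or> a = a mod m + 2 * m" using two_copies a by blast
      ultimately show "a \<in> (\<Union>j<4. {inv (P j) k + m, inv (P j) k + 2 * m})"
        using j(1) by (intro UN_I[of j]) auto
    qed
    then have "card {a \<in> {m..<3 * m}. k \<in> Q a} \<le> card (\<Union>j<4::nat. {inv (P j) k + m, inv (P j) k + 2 * m})"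
      by (intro card_mono) auto
    also have "\<dots> \<le> (\<Sum>j<4::nat. card {inv (P j) k + m, inv (P j) k + 2 * m})"
      by (intro card_UN_le) simp
    also have "\<dots> \<le> (\<Sum>j<4::nat. 2)" by (intro sum_mono) (simp add: card_insert_if)
    finally show "card {a \<in> {m..<3 * m}. k \<in> Q a} \<le> 8" by simp
  qed auto
  then have deg20: "G \<in> bounded_degree_graphs 20"
    using bounded_degree_graphs_mono[of 18 20] by auto
  \<comment> \<open>\<open>X\<close> has at most two vertices per residue, and its set of residues
    expands by two.\<close>
  have hall_cond: "card X \<le> card (\<Union>(Q ` X))" if X: "X \<subseteq> {m..<3 * m}" "400 * card X \<le> m" for X
  proof -
    let ?Y = "(\<lambda>a. a mod m) ` X"
    have finX: "finite X" using X finite_subset by blast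
    have cY: "card ?Y \<le> card X" by (rule card_image_le[OF finX])
    have "X \<subseteq> (\<lambda>y. y + m) ` ?Y \<union> (\<lambda>y. y + 2 * m) ` ?Y"
    proof
      fix a assume a: "a \<in> X"
      then have "a = a mod m + m \<or> a = a mod m + 2 * m"
        using X(1) two_copies by (metis atLeastLessThan_iff subsetD)
      then show "a \<in> (\<lambda>y. y + m) ` ?Y \<union> (\<lambda>y. y + 2 * m) ` ?Y" using a by blast
    qed
    then have "card X \<le> card ((\<lambda>y. y + m) ` ?Y \<union> (\<lambda>y. y + 2 * m) ` ?Y)"
      using finX by (intro card_mono) auto
    also have "\<dots> \<le> card ((\<lambda>y. y + m) ` ?Y) + card ((\<lambda>y. y + 2 * m) ` ?Y)" by (rule card_Un_le)
    also have "\<dots> \<le> card ?Y + card ?Y" using finX by (intro add_mono card_image_le) auto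
    also have "\<dots> \<le> card (\<Union>j<4. P j ` ?Y)"
      using expand[of ?Y] cY X(2) pos by (simp add: image_subset_iff)
    also have "(\<Union>j<4. P j ` ?Y) = \<Union>(Q ` X)" by (auto simp: Q_def)
    finally show ?thesis .
  qed
  \<comment> \<open>On \<open>3 * m\<close> vertices, 1/30000 means
    \<open>10000 * card S \<le> m\<close>, which leaves room for both
    \<open>400 * 19 * card S \<le> m\<close> and \<open>21 * card S < m\<close>. The degree 20 is 18
    plus the two of the added cycle.\<close>
  have "locally_hamiltonian (1 / 30000) (bounded_degree_graphs 20) G"
    unfolding locally_hamiltonian_def
  proof (intro conjI allI impI deg20)
    fix S assume S: "S \<subseteq> verts G" and "real (card S) \<le> 1 / 30000 * real (card (verts G))"
    then have small: "30000 * card S \<le> 3 * m" by (simp add: verts)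
    have "\<exists>H\<in>(bounded_degree_graphs (18 + 2) :: nat ugraph set).
           hamiltonian H \<and> card (verts H) = card (verts G) \<and>
           (\<exists>T f. T \<subseteq> verts H \<and>
              graph_iso f (induced G (closed_nbhd G S)) (induced H (closed_nbhd H T)) \<and>
              f ` S = T)"
      unfolding G_def
    proof (rule insertion_graph_local_witness[OF facts])
      show "insertion_graph m (3 * m) Q \<in> bounded_degree_graphs 18" using deg18 by (simp add: G_def)
      show "S \<subseteq> {..<3 * m}" using S verts by simp
      show "(18 + 3) * card S < m" using small pos by simp
      show "card X \<le> card (\<Union>(Q ` X))" if "X \<subseteq> {m..<3 * m}" "card X \<le> (18 + 1) * card S" for X
        using that small by (intro hall_cond) auto
    qed
    then show "\<exists>H\<in>(bounded_degree_graphs 20 :: nat ugraph set).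
           hamiltonian H \<and> card (verts H) = card (verts G) \<and>
           (\<exists>T f. T \<subseteq> verts H \<and>
              graph_iso f (induced G (closed_nbhd G S)) (induced H (closed_nbhd H T)) \<and>
              f ` S = T)" by simp
  qed
  \<comment> \<open>The independent set has \<open>2 * m\<close> of the \<open>3 * m\<close>
    vertices, so at least \<open>m\<close> edges are missing, while \<open>E\<close> may have at
    most \<open>3 * m / 5\<close>.\<close>
  moreover have "far_from_hamiltonian (1 / 100) 20 G"
  proof (rule far_from_hamiltonian_independent[OF deg20, of "{m..<3 * m}"])
    show "\<not> e \<subseteq> {m..<3 * m}" if "e \<in> edges G" for e
      using that unfolding G_def by (rule insertion_graph_independent[OF facts])
  qed (use pos in \<open>auto simp: verts\<close>)
  ultimately show ?thesis using that[of G] deg20 verts by simp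
qed

theorem theorem5p3:
  shows "\<exists>(d :: nat) (\<delta> :: real) (\<epsilon> :: real) (G :: nat \<Rightarrow> nat ugraph).
    0 < \<delta> \<and> \<delta> < 1 \<and> 0 < \<epsilon> \<and> \<epsilon> < 1 \<and>
    (\<forall>N. G N \<in> bounded_degree_graphs d) \<and>
    strict_mono (\<lambda>N. card (verts (G N))) \<and>
    (\<forall>N. locally_hamiltonian \<delta> (bounded_degree_graphs d) (G N) \<and>
         far_from_hamiltonian \<epsilon> d (G N))"
proof -
  have "\<forall>m. \<exists>G :: nat ugraph. 3 \<le> m \<longrightarrow> card (verts G) = 3 * m \<and> G \<in> bounded_degree_graphs 20 \<and>
      locally_hamiltonian (1 / 30000) (bounded_degree_graphs 20) G \<and> far_from_hamiltonian (1 / 100) 20 G"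
    using ex_locally_hamiltonian_far_from_hamiltonian by metis
  then obtain G :: "nat \<Rightarrow> nat ugraph" where G: "\<And>m. 3 \<le> m \<Longrightarrow> card (verts (G m)) = 3 * m \<and>
      G m \<in> bounded_degree_graphs 20 \<and>
      locally_hamiltonian (1 / 30000) (bounded_degree_graphs 20) (G m) \<and>
      far_from_hamiltonian (1 / 100) 20 (G m)"
    by metis
  \<comment> \<open>The shift by 3 meets the requirement \<open>3 \<le> m\<close>; the orders are
    \<open>3 * (N + 3)\<close>.\<close>
  have "strict_mono (\<lambda>N. card (verts (G (N + 3))))"
    by (rule strict_monoI) (simp add: G)
  then show ?thesis
    using G by (intro exI[of _ 20] exI[of _ "1 / 30000"] exI[of _ "1 / 100"]
        exI[of _ "\<lambda>N. G (N + 3)"]) simp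
qed

end
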